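(* Consider a Nash equilibrium problem of polynomials with $N$ players, objectives $f_i\in\mathbb{R}[x]$ and constraining polynomial tuples $g_i=(g_{i,1},\ldots,g_{i,m_i})$, $g_{i,j}\in\mathbb{R}[x_i]$ (see context). Assume each $g_i$ is nonsingular, and let $\lambda_{i,j}(x)$ be polynomial expressions of Lagrange multipliers, $\lambda_{i,j}(x)=(H_i(x_i)\hat f_i(x))_j$, where $H_i(x_i)G_i(x_i)=I_{m_i}$. Let $\mathcal{G}\subseteq\mathbb{R}^n$ be the set of all $x$ satisfying the KKT system (K) of the context, and let $\mathcal{G}^*$ be the set of all Nash equilibria. If $\mathcal{G}\setminus\mathcal{G}^*$ is finite, with cardinality $\ell^*:=|\mathcal{G}\setminus\mathcal{G}^*|<\infty$, then Algorithm A of the context terminates within at most $\ell^*$ loops (i.e. it stops while the loop counter satisfies $\ell\le\ell^*$).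
   Context: **Nash equilibrium problem (NEP) of polynomials.** There are $N$ players; player $i$ has strategy $x_i\in\mathbb{R}^{n_i}$; $x=(x_1,\ldots,x_N)\in\mathbb{R}^n$, $n=n_1+\cdots+n_N$; $x_{-i}$ is the vector of all blocks except $x_i$, and one writes $x=(x_i,x_{-i})$. $[N]=\{1,\ldots,N\}$. Player $i$ has an objective $f_i\in\mathbb{R}[x]$ and constraining polynomials $g_{i,j}\in\mathbb{R}[x_i]$, $j\in[m_i]=\mathcal{E}_i\sqcup\mathcal{I}_i$, with feasible set $X_i=\{x_i\in\mathbb{R}^{n_i}: g_{i,j}(x_i)=0\ (j\in\mathcal{E}_i),\ g_{i,j}(x_i)\ge0\ (j\in\mathcal{I}_i)\}$. A Nash equilibrium (NE) is a point $x^*$ such that for every $i$, $x_i^*$ is a (global) minimizer of $f_i(\cdot,x_{-i}^* )$ over $X_i$. **Nonsingularity and multiplier expressions.** Let $G_i(x_i)$ be the $(n_i+m_i)\times m_i$ matrix polynomial whose top $n_i$ rows are $[\nabla_{x_i}g_{i,1}(x_i)\ \cdots\ \nabla_{x_i}g_{i,m_i}(x_i)]$ and whose bottom $m_i$ rows are $\mathrm{diag}(g_{i,1}(x_i),\ldots,g_{i,m_i}(x_i))$. The tuple $g_i$ is nonsingular if $G_i(x_i)$ has full column rank for every $x_i\in\mathbb{C}^{n_i}$. In that case there is a matrix polynomial $H_i(x_i)$ with real coefficients such that $H_i(x_i)G_i(x_i)=I_{m_i}$; fix one. Let $\hat f_i(x)=(\nabla_{x_i}f_i(x),0,\ldots,0)\in\mathbb{R}^{n_i+m_i}$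 and $\lambda_{i,j}(x):=(H_i(x_i)\hat f_i(x))_j$. **System (K).** For all $i\in[N]$: $\nabla_{x_i}f_i(x)-\sum_{j=1}^{m_i}\lambda_{i,j}(x)\nabla_{x_i}g_{i,j}(x_i)=0$; $g_{i,j}(x_i)=0$ for $j\in\mathcal{E}_i$; and $\lambda_{i,j}(x)g_{i,j}(x_i)=0$, $g_{i,j}(x_i)\ge0$, $\lambda_{i,j}(x)\ge0$ for $j\in\mathcal{I}_i$. **Problem (U).** For finite sets $\mathcal{K}_i\subseteq X_i$, a symmetric positive definite $\Theta\in\mathbb{R}^{(n+1)\times(n+1)}$ and $[x]_1:=(1,x^T)^T\in\mathbb{R}^{n+1}$: minimize $[x]_1^T\Theta[x]_1$ over all $x\in\mathbb{R}^n$ satisfying (K) and $f_i(v,x_{-i})-f_i(x_i,x_{-i})\ge0$ for all $v\in\mathcal{K}_i$, $i\in[N]$. **Problem (L$_i(u)$).** For $u\in\mathbb{R}^n$: $\omega_i:=\min\{f_i(x_i,u_{-i})-f_i(u_i,u_{-i}): x_i\in X_i\}$. **Algorithm A** (all optimization problems are solved exactly; it is understood that each problem (L$_i(u)$) that is encountered has a minimizer). Step 0: set $\mathcal{K}_i:=\emptyset$ for all $i$, $\ell:=0$; choose a generic positive definite matrix $\Theta$ of size $n+1$ (generic: outside a set of Lebesgue measure zero). Step 1: solve (U). If it is infeasible, output that there is no NE and stop; otherwise let $u$ be an optimizer. Step 2: solve (L$_i(u)$) for each $i$. If all $\omega_i\ge0$, output the NE $u$ and stop; otherwise go to Step 3.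 Step 3: for each $i$ with $\omega_i<0$, obtain a nonempty finite set $U_i$ of some (not necessarily all) optimizers of (L$_i(u)$) and replace $\mathcal{K}_i$ by $\mathcal{K}_i\cup U_i$. Replace $\ell$ by $\ell+1$ and go to Step 1. The initial pass corresponds to $\ell=0$. *)

theory Defs
  imports
    "HOL-Analysis.Analysis"
    "HOL-Library.Poly_Mapping"
    "Jordan_Normal_Form.DL_Rank"
begin

section \<open>Multivariate polynomials\<close>

text \<open>A polynomial maps monomials (finitely supported exponent vectors) to coefficients;
  addition and multiplication are those of \<^theory>\<open>HOL-Library.Poly_Mapping\<close>.\<close>

type_synonym 'v rpoly = "('v \<Rightarrow>\<^sub>0 nat) \<Rightarrow>\<^sub>0 real"

definition pvars :: "'v rpoly \<Rightarrow> 'v set" where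
  "pvars p = (\<Union>m\<in>Poly_Mapping.keys p. Poly_Mapping.keys m)"

text \<open>Real polynomials are evaluated at real as well as at complex points.\<close>

definition peval :: "('v \<Rightarrow> 'a) \<Rightarrow> 'v rpoly \<Rightarrow> 'a::{comm_ring_1, real_algebra_1}" where
  "peval z p = (\<Sum>m\<in>Poly_Mapping.keys p. of_real (Poly_Mapping.lookup p m) *
     (\<Prod>v\<in>Poly_Mapping.keys m. z v ^ Poly_Mapping.lookup m v))"

text \<open>Formal partial derivative. The subtraction of exponent vectors truncates only for monomials
  in which \<open>v\<close> does not occur, and these get the coefficient 0.\<close>

definition pdiff :: "'v \<Rightarrow> 'v rpoly \<Rightarrow> 'v rpoly" where
  "pdiff v p = (\<Sum>m\<in>Poly_Mapping.keys p.
     Poly_Mapping.single (m - Poly_Mapping.single v 1)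
       (of_nat (Poly_Mapping.lookup m v) * Poly_Mapping.lookup p m))"

section \<open>Nash equilibrium problems of polynomials\<close>

text \<open>Players, coordinates and constraints are numbered from 0. The variable \<open>(i, k)\<close> of an
  objective is the \<open>k\<close>-th coordinate of the strategy of player \<open>i\<close>.\<close>

record nep =
  players :: nat                              \<comment> \<open>\<open>N\<close>\<close>
  dims :: "nat \<Rightarrow> nat"                        \<comment> \<open>\<open>n\<^sub>i\<close>\<close>
  obj :: "nat \<Rightarrow> (nat \<times> nat) rpoly"           \<comment> \<open>\<open>f\<^sub>i\<close>\<close>
  ncons :: "nat \<Rightarrow> nat"                       \<comment> \<open>\<open>m\<^sub>i\<close>\<close>
  con :: "nat \<Rightarrow> nat \<Rightarrow> nat rpoly"            \<comment> \<open>\<open>g\<^sub>i\<^sub>,\<^sub>j\<close>\<close>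
  eqs :: "nat \<Rightarrow> nat set"
  ineqs :: "nat \<Rightarrow> nat set"

definition is_nep :: "nep \<Rightarrow> bool" where
  "is_nep P \<longleftrightarrow> (\<forall>i<players P.
     pvars (obj P i) \<subseteq> (SIGMA i:{..<players P}. {..<dims P i}) \<and>
     (\<forall>j<ncons P i. pvars (con P i j) \<subseteq> {..<dims P i}) \<and>
     eqs P i \<union> ineqs P i = {..<ncons P i} \<and> eqs P i \<inter> ineqs P i = {})"

text \<open>\<open>\<real>\<^sup>d\<close> is the set of functions on \<open>{..<d}\<close>, extended by \<open>undefined\<close>, and a point
  \<open>x = (x\<^sub>1,\<dots>,x\<^sub>N)\<close> is the function \<open>i \<mapsto> x\<^sub>i\<close>. Hence \<open>(v, x\<^sub>-\<^sub>i)\<close> is \<open>x(i := v)\<close>.\<close>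

type_synonym point = "nat \<Rightarrow> nat \<Rightarrow> real"

definition space_of :: "nep \<Rightarrow> point set" where
  "space_of P = PiE {..<players P} (\<lambda>i. PiE {..<dims P i} (\<lambda>_. UNIV))"

definition peval2 :: "point \<Rightarrow> (nat \<times> nat) rpoly \<Rightarrow> real" where
  "peval2 x p = peval (\<lambda>(i, k). x i k) p"

definition feas :: "nep \<Rightarrow> nat \<Rightarrow> (nat \<Rightarrow> real) set" where
  "feas P i = {v \<in> PiE {..<dims P i} (\<lambda>_. UNIV).
     (\<forall>j\<in>eqs P i. peval v (con P i j) = 0) \<and> (\<forall>j\<in>ineqs P i. peval v (con P i j) \<ge> 0)}"

definition nash_equilibria :: "nep \<Rightarrow> point set" where
  "nash_equilibria P = {x \<in> space_of P. \<forall>i<players P.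
     is_arg_min (\<lambda>v. peval2 (x(i := v)) (obj P i)) (\<lambda>v. v \<in> feas P i) (x i)}"

section \<open>Nonsingularity and Lagrange multiplier expressions\<close>

definition Gmat :: "nep \<Rightarrow> nat \<Rightarrow> nat rpoly mat" where
  "Gmat P i = Matrix.mat (dims P i) (ncons P i) (\<lambda>(k, j). pdiff k (con P i j))
              @\<^sub>r mat_diag (ncons P i) (con P i)"

definition nonsingular :: "nep \<Rightarrow> nat \<Rightarrow> bool" where
  "nonsingular P i \<longleftrightarrow> (\<forall>z \<in> PiE {..<dims P i} (\<lambda>_. UNIV :: complex set).
     vec_space.rank (dims P i + ncons P i) (map_mat (peval z) (Gmat P i)) = ncons P i)"

definition is_left_inverse :: "nep \<Rightarrow> nat \<Rightarrow> nat rpoly mat \<Rightarrow> bool" where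
  "is_left_inverse P i H \<longleftrightarrow>
     H \<in> carrier_mat (ncons P i) (dims P i + ncons P i) \<and>
     (\<forall>p \<in> elements_mat H. pvars p \<subseteq> {..<dims P i}) \<and>
     H * Gmat P i = 1\<^sub>m (ncons P i)"

definition fhat :: "nep \<Rightarrow> nat \<Rightarrow> point \<Rightarrow> real Matrix.vec" where
  "fhat P i x = Matrix.vec (dims P i) (\<lambda>k. peval2 x (pdiff (i, k) (obj P i))) @\<^sub>v 0\<^sub>v (ncons P i)"

definition multiplier :: "nep \<Rightarrow> (nat \<Rightarrow> nat rpoly mat) \<Rightarrow> nat \<Rightarrow> nat \<Rightarrow> point \<Rightarrow> real" where
  "multiplier P H i j x = vec_index (map_mat (peval (x i)) (H i) *\<^sub>v fhat P i x) j"

definition kkt :: "nep \<Rightarrow> (nat \<Rightarrow> nat rpoly mat) \<Rightarrow> point set" where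
  "kkt P H = {x \<in> space_of P. \<forall>i<players P.
     (\<forall>k<dims P i. peval2 x (pdiff (i, k) (obj P i))
        - (\<Sum>j<ncons P i. multiplier P H i j x * peval (x i) (pdiff k (con P i j))) = 0) \<and>
     (\<forall>j\<in>eqs P i. peval (x i) (con P i j) = 0) \<and>
     (\<forall>j\<in>ineqs P i. multiplier P H i j x * peval (x i) (con P i j) = 0 \<and>
        peval (x i) (con P i j) \<ge> 0 \<and> multiplier P H i j x \<ge> 0)}"

section \<open>The optimization problems\<close>

definition total_dim :: "nep \<Rightarrow> nat" where
  "total_dim P = (\<Sum>i<players P. dims P i)"

text \<open>\<open>[x]\<^sub>1 = (1, x\<^sup>T)\<^sup>T\<close>, with the blocks of \<open>x\<close> concatenated.\<close>

definition bracket1 :: "nep \<Rightarrow> point \<Rightarrow> real Matrix.vec" where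
  "bracket1 P x =
     vec_of_list (1 # concat (map (\<lambda>i. map (x i) [0..<dims P i]) [0..<players P]))"

definition quad :: "nep \<Rightarrow> real mat \<Rightarrow> point \<Rightarrow> real" where
  "quad P \<Theta> x = scalar_prod (bracket1 P x) (\<Theta> *\<^sub>v bracket1 P x)"

definition pos_def :: "nat \<Rightarrow> real mat \<Rightarrow> bool" where
  "pos_def d A \<longleftrightarrow> A \<in> carrier_mat d d \<and> transpose_mat A = A \<and>
     (\<forall>v \<in> carrier_vec d. v \<noteq> 0\<^sub>v d \<longrightarrow> scalar_prod v (A *\<^sub>v v) > 0)"

text \<open>A symmetric \<open>d \<times> d\<close> matrix is given by its entries on and above the diagonal. A property is
  generic if it holds for almost all of these entries. (In the space of all \<open>d \<times> d\<close> matrices the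
  symmetric ones would form a null set for \<open>d \<ge> 2\<close>.)\<close>

definition upper_entries :: "nat \<Rightarrow> (nat \<times> nat \<Rightarrow> real) measure" where
  "upper_entries d = (\<Pi>\<^sub>M p\<in>{(a, b). a \<le> b \<and> b < d}. lborel)"

definition sym_mat :: "nat \<Rightarrow> (nat \<times> nat \<Rightarrow> real) \<Rightarrow> real mat" where
  "sym_mat d \<theta> = Matrix.mat d d (\<lambda>(a, b). \<theta> (min a b, max a b))"

type_synonym cuts = "nat \<Rightarrow> (nat \<Rightarrow> real) set"

definition U_feas :: "nep \<Rightarrow> (nat \<Rightarrow> nat rpoly mat) \<Rightarrow> cuts \<Rightarrow> point set" where
  "U_feas P H K = {x \<in> kkt P H. \<forall>i<players P. \<forall>v\<in>K i.
     peval2 (x(i := v)) (obj P i) - peval2 x (obj P i) \<ge> 0}"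

definition U_opt :: "nep \<Rightarrow> (nat \<Rightarrow> nat rpoly mat) \<Rightarrow> real mat \<Rightarrow> cuts \<Rightarrow> point \<Rightarrow> bool" where
  "U_opt P H \<Theta> K u \<longleftrightarrow> is_arg_min (quad P \<Theta>) (\<lambda>x. x \<in> U_feas P H K) u"

definition L_obj :: "nep \<Rightarrow> nat \<Rightarrow> point \<Rightarrow> (nat \<Rightarrow> real) \<Rightarrow> real" where
  "L_obj P i u v = peval2 (u(i := v)) (obj P i) - peval2 u (obj P i)"

definition L_opt :: "nep \<Rightarrow> nat \<Rightarrow> point \<Rightarrow> (nat \<Rightarrow> real) \<Rightarrow> bool" where
  "L_opt P i u v \<longleftrightarrow> is_arg_min (L_obj P i u) (\<lambda>v. v \<in> feas P i) v"

definition L_value :: "nep \<Rightarrow> nat \<Rightarrow> point \<Rightarrow> real \<Rightarrow> bool" where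
  "L_value P i u w \<longleftrightarrow> (\<exists>v. L_opt P i u v \<and> w = L_obj P i u v)"

section \<open>The algorithm\<close>

text \<open>A state is the step to be executed next together with the current data; the last natural
  number of each state is the loop counter. \<open>Step3\<close> carries the values \<open>\<omega>\<close> found in Step 2.\<close>

datatype result = No_NE | NE point

datatype state =
    Step1 cuts nat
  | Step2 cuts point nat
  | Step3 cuts point "nat \<Rightarrow> real" nat
  | Stopped result nat

inductive step :: "nep \<Rightarrow> (nat \<Rightarrow> nat rpoly mat) \<Rightarrow> real mat \<Rightarrow> state \<Rightarrow> state \<Rightarrow> bool"
  for P H \<Theta> where
  infeasible: "U_feas P H K = {} \<Longrightarrow> step P H \<Theta> (Step1 K l) (Stopped No_NE l)"
| optimizer: "U_opt P H \<Theta> K u \<Longrightarrow> step P H \<Theta> (Step1 K l) (Step2 K u l)"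
| found: "\<forall>i<players P. L_value P i u (\<omega> i) \<Longrightarrow> \<forall>i<players P. \<omega> i \<ge> 0 \<Longrightarrow>
    step P H \<Theta> (Step2 K u l) (Stopped (NE u) l)"
| not_NE: "\<forall>i<players P. L_value P i u (\<omega> i) \<Longrightarrow> \<exists>i<players P. \<omega> i < 0 \<Longrightarrow>
    step P H \<Theta> (Step2 K u l) (Step3 K u \<omega> l)"
| add_cuts: "\<forall>i<players P. \<omega> i < 0 \<longrightarrow>
      finite (V i) \<and> V i \<noteq> {} \<and> (\<forall>v\<in>V i. L_opt P i u v) \<Longrightarrow>
    step P H \<Theta> (Step3 K u \<omega> l)
      (Step1 (\<lambda>i. if i < players P \<and> \<omega> i < 0 then K i \<union> V i else K i) (Suc l))"

definition initial :: state where
  "initial = Step1 (\<lambda>_. {}) 0"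

definition infinite_run :: "nep \<Rightarrow> (nat \<Rightarrow> nat rpoly mat) \<Rightarrow> real mat \<Rightarrow> (nat \<Rightarrow> state) \<Rightarrow> bool" where
  "infinite_run P H \<Theta> \<sigma> \<longleftrightarrow> \<sigma> 0 = initial \<and> (\<forall>t. step P H \<Theta> (\<sigma> t) (\<sigma> (Suc t)))"

definition maximal_run :: "nep \<Rightarrow> (nat \<Rightarrow> nat rpoly mat) \<Rightarrow> real mat \<Rightarrow> state list \<Rightarrow> bool" where
  "maximal_run P H \<Theta> ss \<longleftrightarrow> ss \<noteq> [] \<and> hd ss = initial \<and> successively (step P H \<Theta>) ss \<and>
     (\<nexists>s. step P H \<Theta> (last ss) s)"

text \<open>Every problem \<open>(L\<^sub>i(u))\<close> encountered in the run has a minimizer.\<close>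

definition L_solvable :: "nep \<Rightarrow> state list \<Rightarrow> bool" where
  "L_solvable P ss \<longleftrightarrow> (\<forall>K u l. Step2 K u l \<in> set ss \<longrightarrow> (\<forall>i<players P. \<exists>v. L_opt P i u v))"

text \<open>Whatever optimizers are chosen, the algorithm cannot run forever, and it cannot get stuck:
  it ends in a stopped state, with loop counter at most \<open>L\<close>. In an infinite run all encountered
  problems \<open>(L\<^sub>i(u))\<close> have minimizers by the rules \<open>found\<close> and \<open>not_NE\<close>.\<close>

definition terminates_within ::
  "nep \<Rightarrow> (nat \<Rightarrow> nat rpoly mat) \<Rightarrow> real mat \<Rightarrow> nat \<Rightarrow> bool" where
  "terminates_within P H \<Theta> L \<longleftrightarrow>
     (\<nexists>\<sigma>. infinite_run P H \<Theta> \<sigma>) \<and>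
     (\<forall>ss. maximal_run P H \<Theta> ss \<and> L_solvable P ss \<longrightarrow>
        (\<exists>r l. last ss = Stopped r l \<and> l \<le> L))"

end

theory Submission
  imports Defs
begin

text \<open>If Step 3 is entered with \<open>u\<close>, then \<open>u\<close> is a KKT point that is not an equilibrium, and the cuts
  added there make \<open>u\<close> infeasible for all later problems \<open>(U)\<close>. So every loop removes a further
  point of the finite set \<open>\<G> \<setminus> \<G>\<^sup>*\<close> from the feasible set. The algorithm cannot get stuck in
  Step 1, since the feasible set is closed and a positive definite quadratic form is coercive.\<close>

section \<open>Coercivity of positive definite quadratic forms\<close>

text \<open>Tychonoff's theorem, carried over to the type class topology on functions, which is the
  product topology.\<close>

lemma compact_PiE_UNIV:
  fixes S :: "'i \<Rightarrow> 'a::topological_space set"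
  assumes "\<And>i. compact (S i)"
  shows "compact (PiE UNIV S)"
  using assms compactin_PiE[of "\<lambda>_. euclidean" UNIV S]
  by (simp add: euclidean_product_topology)

text \<open>Turns the form into a finite sum over entries, so that continuity can be argued
  coordinate by coordinate.\<close>

lemma scalar_prod_mult_mat_vec:
  fixes A :: "real mat"
  assumes "A \<in> carrier_mat d d" and "v \<in> carrier_vec d"
  shows "scalar_prod v (A *\<^sub>v v) =
    (\<Sum>a<d. \<Sum>b<d. vec_index v a * A $$ (a, b) * vec_index v b)"
proof -
  have "scalar_prod v (A *\<^sub>v v) = (\<Sum>a<d. vec_index v a * (\<Sum>b<d. A $$ (a, b) * vec_index v b))"
    using assms by (auto simp: scalar_prod_def atLeast0LessThan intro!: sum.cong)
  then show ?thesis
    by (simp add: sum_distrib_left mult.assoc)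
qed

text \<open>The form is continuous on the compact unit sphere, so it attains a minimum there, which
  is positive by definiteness. This minimum serves as \<open>\<alpha>\<close>; scaling extends the
  bound to all vectors.\<close>

lemma pos_def_coercive:
  assumes A: "pos_def d A"
  obtains \<alpha> where "\<alpha> > 0"
    and "\<And>v. v \<in> carrier_vec d \<Longrightarrow> \<alpha> * (\<Sum>a<d. (vec_index v a)\<^sup>2) \<le> scalar_prod v (A *\<^sub>v v)"
\<comment> \<open>In dimension 0 the unit sphere is empty and has no minimum, but both sides of the
  bound are 0.\<close>
proof (cases "d = 0")
  case True
  then show ?thesis using that[of 1] by (auto simp: scalar_prod_def)
next
  case False
  have Ac: "A \<in> carrier_mat d d" using A by (simp add: pos_def_def)
  define q where "q g = (\<Sum>a<d. \<Sum>b<d. g a * A $$ (a, b) * g b)" for g :: "nat \<Rightarrow> real"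
  have q: "scalar_prod (Matrix.vec d g) (A *\<^sub>v Matrix.vec d g) = q g" for g
    unfolding q_def by (subst scalar_prod_mult_mat_vec[OF Ac]) auto
  \<comment> \<open>Vectors are modelled by functions on all of \<open>nat\<close>; pinning the
    coordinates from \<open>d\<close> on to 0 makes the sphere \<open>S\<close> compact in the
    infinite product.\<close>
  define B where "B = PiE UNIV (\<lambda>a. if a < d then {-1..1::real} else {0})"
  define S where "S = B \<inter> {g. (\<Sum>a<d. (g a)\<^sup>2) = 1}"
  have "compact B"
    unfolding B_def by (rule compact_PiE_UNIV) auto
  moreover have "closed {g::nat \<Rightarrow> real. (\<Sum>a<d. (g a)\<^sup>2) = 1}"
    by (intro closed_Collect_eq continuous_intros continuous_on_product_coordinates)
  ultimately have "compact S"
    unfolding S_def by (rule compact_Int_closed)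
  \<comment> \<open>The first unit vector, available because \<open>d\<close> is positive.\<close>
  have "(\<lambda>a. if a = 0 then 1 else 0) \<in> S"
    using False by (auto simp: S_def B_def if_distrib[of "\<lambda>x. x\<^sup>2"] sum.delta cong: if_cong)
  then have "S \<noteq> {}" by blast
  have "continuous_on S q"
    unfolding q_def
    by (intro continuous_intros continuous_on_subset[OF continuous_on_product_coordinates]) auto
  then obtain g0 where g0: "g0 \<in> S" "\<And>g. g \<in> S \<Longrightarrow> q g0 \<le> q g"
    using continuous_attains_inf[OF \<open>compact S\<close> \<open>S \<noteq> {}\<close>] by blast
  have "Matrix.vec d g0 \<noteq> 0\<^sub>v d"
  proof
    assume eq: "Matrix.vec d g0 = 0\<^sub>v d"
    have "g0 a = 0" if "a < d" for a
      using arg_cong[OF eq, of "\<lambda>v. vec_index v a"] that by simp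
    then show False using g0(1) by (simp add: S_def)
  qed
  then have pos: "q g0 > 0"
    using A q[of g0] by (auto simp: pos_def_def)
  show ?thesis
  proof (rule that[OF pos])
    fix v :: "real Matrix.vec"
    assume v: "v \<in> carrier_vec d"
    define n where "n = (\<Sum>a<d. (vec_index v a)\<^sup>2)"
    have n0: "n \<ge> 0" by (simp add: n_def sum_nonneg)
    have qv: "scalar_prod v (A *\<^sub>v v) = q (vec_index v)"
      using scalar_prod_mult_mat_vec[OF Ac v] by (simp add: q_def)
    have "q g0 * n \<le> q (vec_index v)"
    proof (cases "n = 0")
      case True
      then have "vec_index v a = 0" if "a < d" for a
        using that by (simp add: n_def sum_nonneg_eq_0_iff)
      then show ?thesis using True by (simp add: q_def)
    next
      case False
      define s where "s = sqrt n"
      have s: "s > 0" "s * s = n" using False n0 by (auto simp: s_def)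
      \<comment> \<open>The vector \<open>v\<close> scaled to norm 1, extended by 0 so that it lies
        in \<open>B\<close>.\<close>
      define g where "g a = (if a < d then vec_index v a / s else 0)" for a
      have sum1: "(\<Sum>a<d. (g a)\<^sup>2) = 1"
      proof -
        have "(\<Sum>a<d. (g a)\<^sup>2) = (\<Sum>a<d. (vec_index v a)\<^sup>2 / n)"
          using s by (intro sum.cong) (auto simp: g_def power2_eq_square)
        also have "\<dots> = n / n" unfolding n_def by (rule sum_divide_distrib[symmetric])
        finally show ?thesis using False by simp
      qed
      have "\<bar>g a\<bar> \<le> 1" if "a < d" for a
      proof -
        have "(g a)\<^sup>2 \<le> (\<Sum>a<d. (g a)\<^sup>2)"
          using that by (intro member_le_sum) auto
        then show ?thesis using sum1 by (simp add: abs_square_le_1)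
      qed
      then have "-1 \<le> g a \<and> g a \<le> 1" if "a < d" for a
        using that by (simp add: abs_le_iff)
      moreover have "g a = 0" if "\<not> a < d" for a
        using that by (simp add: g_def)
      ultimately have "g \<in> B" by (simp add: B_def PiE_iff)
      then have "g \<in> S" using sum1 by (simp add: S_def)
      then have "q g0 \<le> q g" by (rule g0)
      also have "q g = q (vec_index v) / n"
        unfolding q_def sum_divide_distrib using s by (intro sum.cong) (auto simp: g_def)
      finally show ?thesis using False n0 by (simp add: field_simps)
    qed
    then show "q g0 * (\<Sum>a<d. (vec_index v a)\<^sup>2) \<le> scalar_prod v (A *\<^sub>v v)"
      by (simp add: qv n_def)
  qed
qed

section \<open>Solvability of problem (U)\<close>

lemma continuous_on_peval:
  "continuous_on UNIV (\<lambda>z::'v \<Rightarrow> real. peval z p)"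
  unfolding peval_def
  by (intro continuous_intros continuous_on_product_coordinates)

lemma continuous_on_point_coord: "continuous_on UNIV (\<lambda>x::point. x i k)"
  by (rule continuous_on_product_then_coordinatewise[OF continuous_on_product_coordinates])

lemma continuous_on_peval_block: "continuous_on UNIV (\<lambda>x::point. peval (x i) p)"
  by (rule continuous_on_compose2[OF continuous_on_peval])
     (auto intro: continuous_on_product_coordinates)

lemma continuous_on_peval2: "continuous_on UNIV (\<lambda>x. peval2 x p)"
  unfolding peval2_def
proof (rule continuous_on_compose2[OF continuous_on_peval])
  show "continuous_on UNIV (\<lambda>x::point. \<lambda>(i, k). x i k)"
  proof (rule continuous_on_coordinatewise_then_product)
    show "continuous_on UNIV (\<lambda>x::point. case p of (i, k) \<Rightarrow> x i k)" for p
      by (cases p) (simp add: continuous_on_point_coord)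
  qed
qed auto

lemma continuous_on_peval2_upd: "continuous_on UNIV (\<lambda>x. peval2 (x(i := v)) p)"
proof (rule continuous_on_compose2[OF continuous_on_peval2])
  show "continuous_on UNIV (\<lambda>x::point. x(i := v))"
  proof (rule continuous_on_coordinatewise_then_product)
    show "continuous_on UNIV (\<lambda>x::point. (x(i := v)) a)" for a
      by (cases "a = i") auto
  qed
qed auto

text \<open>The last \<open>ncons P i\<close> entries of \<open>fhat P i x\<close> vanish, so row
  \<open>j\<close> of the matrix-vector product is a finite sum of products of polynomial
  values.\<close>

lemma continuous_on_multiplier:
  assumes "is_left_inverse P i (H i)" and "j < ncons P i"
  shows "continuous_on UNIV (multiplier P H i j)"
proof -
  let ?d = "dims P i + ncons P i"
  have H: "H i \<in> carrier_mat (ncons P i) ?d"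
    using assms(1) by (simp add: is_left_inverse_def)
  have "multiplier P H i j x = (\<Sum>a<?d. peval (x i) (H i $$ (j, a)) *
      (if a < dims P i then peval2 x (pdiff (i, a) (obj P i)) else 0))" for x
    using H assms(2)
    by (auto simp: multiplier_def fhat_def scalar_prod_def atLeast0LessThan intro!: sum.cong)
  moreover have "continuous_on UNIV
      (\<lambda>x. if a < dims P i then peval2 x (pdiff (i, a) (obj P i)) else 0)" for a
    by (cases "a < dims P i") (auto intro: continuous_on_peval2)
  ultimately show ?thesis
    by (auto intro!: continuous_intros continuous_on_peval_block)
qed

text \<open>Expresses membership by equations on single real coordinates, each of which is a closed
  condition. Two defaults occur: for a player index in range the excess coordinates are the real
  number \<open>undefined\<close>, while outside that range the whole block is the function
  \<open>undefined\<close>.\<close>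

lemma space_of_eq:
  "space_of P = {x. \<forall>i k. \<not> (i < players P \<and> k < dims P i) \<longrightarrow>
     x i k = (if i < players P then undefined else (undefined :: nat \<Rightarrow> real) k)}"
proof -
  have "x i = undefined \<longleftrightarrow> (\<forall>k. x i k = (undefined :: nat \<Rightarrow> real) k)" for x :: point and i
    by auto
  then show ?thesis
    by (auto simp: space_of_def PiE_iff extensional_def)
qed

lemma closed_Collect_less_imp:
  fixes n :: nat and Q :: "nat \<Rightarrow> 'a::topological_space \<Rightarrow> bool"
  assumes "\<And>i. i < n \<Longrightarrow> closed {x. Q i x}"
  shows "closed {x. \<forall>i<n. Q i x}"
  using assms by (auto simp: Collect_all_eq Collect_imp_eq intro!: closed_INT)

lemma closed_Collect_Ball:
  assumes "\<And>i. i \<in> I \<Longrightarrow> closed {x. Q i x}"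
  shows "closed {x. \<forall>i\<in>I. Q i x}"
  using assms by (auto simp: Collect_ball_eq)

lemma closed_space_of: "closed (space_of P)"
  unfolding space_of_eq
  by (intro closed_Collect_all closed_Collect_imp open_Collect_const closed_Collect_eq
      continuous_on_point_coord continuous_on_const)

text \<open>All conditions are equations or weak inequalities between continuous functions.
  Arbitrary intersections of closed sets are closed, so the cut sets \<open>K i\<close> may be
  infinite here.\<close>

lemma closed_U_feas:
  assumes "is_nep P" and "\<forall>i<players P. is_left_inverse P i (H i)"
  shows "closed (U_feas P H K)"
proof -
  have mult: "continuous_on UNIV (multiplier P H i j)" if "i < players P" "j < ncons P i" for i j
    using assms(2) that by (intro continuous_on_multiplier) auto
  have ineq: "j < ncons P i" if "i < players P" "j \<in> ineqs P i" for i j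
    using assms(1) that by (auto simp: is_nep_def)
  have constraint: "closed {x::point. peval (x i) (con P i j) = 0}"
    "closed {x::point. peval (x i) (con P i j) \<ge> 0}" for i j
    by (rule closed_Collect_eq closed_Collect_le continuous_on_peval_block continuous_on_const)+
  have gradient: "closed {x. peval2 x (pdiff (i, k) (obj P i))
      - (\<Sum>j<ncons P i. multiplier P H i j x * peval (x i) (pdiff k (con P i j))) = 0}"
    if "i < players P" for i k
    using that by (intro closed_Collect_eq continuous_on_diff continuous_on_sum continuous_on_mult
        continuous_on_const continuous_on_peval2 continuous_on_peval_block mult) auto
  have complementarity: "closed {x. multiplier P H i j x * peval (x i) (con P i j) = 0}"
    "closed {x. multiplier P H i j x \<ge> 0}"
    if "i < players P" "j \<in> ineqs P i" for i j
    by (rule closed_Collect_eq closed_Collect_le continuous_on_mult continuous_on_const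
        continuous_on_peval_block mult[OF that(1) ineq[OF that]])+
  have cut: "closed {x. peval2 (x(i := v)) (obj P i) - peval2 x (obj P i) \<ge> 0}" for i v
    by (intro closed_Collect_le continuous_on_diff continuous_on_const continuous_on_peval2
        continuous_on_peval2_upd)
  have "closed {x. \<forall>i<players P.
      (\<forall>k<dims P i. peval2 x (pdiff (i, k) (obj P i))
        - (\<Sum>j<ncons P i. multiplier P H i j x * peval (x i) (pdiff k (con P i j))) = 0) \<and>
      (\<forall>j\<in>eqs P i. peval (x i) (con P i j) = 0) \<and>
      (\<forall>j\<in>ineqs P i. multiplier P H i j x * peval (x i) (con P i j) = 0 \<and>
        peval (x i) (con P i j) \<ge> 0 \<and> multiplier P H i j x \<ge> 0)}"
    by (intro closed_Collect_less_imp closed_Collect_conj closed_Collect_Ball constraint gradient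
        complementarity)
  then have "closed (kkt P H)"
    unfolding kkt_def using closed_space_of by (simp add: Collect_conj_eq closed_Int)
  moreover have "closed {x. \<forall>i<players P. \<forall>v\<in>K i.
      peval2 (x(i := v)) (obj P i) - peval2 x (obj P i) \<ge> 0}"
    by (intro closed_Collect_less_imp closed_Collect_Ball cut)
  ultimately show ?thesis
    unfolding U_feas_def by (simp add: Collect_conj_eq closed_Int del: diff_ge_0_iff_ge)
qed

section \<open>Compact sublevel sets and minimizers of (U)\<close>

text \<open>The order in which \<open>bracket1\<close> concatenates the blocks; it links positions
  in that vector to the variables \<open>(i, k)\<close>.\<close>

definition coord_pairs :: "nep \<Rightarrow> (nat \<times> nat) list" where
  "coord_pairs P = concat (map (\<lambda>i. map (Pair i) [0..<dims P i]) [0..<players P])"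

lemma length_coord_pairs: "length (coord_pairs P) = total_dim P"
  by (simp add: coord_pairs_def total_dim_def length_concat o_def interv_sum_list_conv_sum_set_nat
      atLeast0LessThan)

lemma set_coord_pairs: "set (coord_pairs P) = (SIGMA i:{..<players P}. {..<dims P i})"
  by (auto simp: coord_pairs_def)

lemma bracket1_coord_pairs:
  "bracket1 P x = vec_of_list (1 # map (\<lambda>(i, k). x i k) (coord_pairs P))"
  by (simp add: bracket1_def coord_pairs_def map_concat o_def)

lemma bracket1_carrier: "bracket1 P x \<in> carrier_vec (total_dim P + 1)"
  unfolding bracket1_coord_pairs carrier_vec_def
  by (simp add: length_coord_pairs)

text \<open>The leading entry 1 shifts the coordinates by one position.\<close>

lemma bracket1_index:
  assumes "a < total_dim P + 1"
  shows "vec_index (bracket1 P x) a =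
    (case a of 0 \<Rightarrow> 1 | Suc b \<Rightarrow> x (fst (coord_pairs P ! b)) (snd (coord_pairs P ! b)))"
  using assms
  by (auto simp: bracket1_coord_pairs vec_of_list_index length_coord_pairs split_beta
      simp del: vec_of_list_Cons split: nat.split)

lemma continuous_on_quad:
  assumes "\<Theta> \<in> carrier_mat (total_dim P + 1) (total_dim P + 1)"
  shows "continuous_on UNIV (quad P \<Theta>)"
proof -
  have "continuous_on UNIV (\<lambda>x. vec_index (bracket1 P x) a)" if "a < total_dim P + 1" for a
    unfolding bracket1_index[OF that]
    by (cases a) (auto intro: continuous_on_point_coord)
  then show ?thesis
    unfolding quad_def scalar_prod_mult_mat_vec[OF assms bracket1_carrier]
    by (auto intro!: continuous_intros)
qed

text \<open>Coercivity bounds every coordinate, so the set is a closed subset of a compact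
  box.\<close>

lemma compact_quad_sublevel:
  assumes "pos_def (total_dim P + 1) \<Theta>"
  shows "compact (space_of P \<inter> {x. quad P \<Theta> x \<le> c})"
proof -
  let ?d = "total_dim P + 1"
  have \<Theta>: "\<Theta> \<in> carrier_mat ?d ?d" using assms by (simp add: pos_def_def)
  obtain \<alpha> where \<alpha>: "\<alpha> > 0" "\<And>v. v \<in> carrier_vec ?d \<Longrightarrow>
      \<alpha> * (\<Sum>a<?d. (vec_index v a)\<^sup>2) \<le> scalar_prod v (\<Theta> *\<^sub>v v)"
    using pos_def_coercive[OF assms] by blast
  \<comment> \<open>Solves \<open>\<alpha> * (x i k)\<^sup>2 \<le> c\<close> for the coordinate. If
    \<open>c\<close> is negative, the sublevel set is empty and the bound below is vacuous.\<close>
  define r where "r = sqrt (c / \<alpha>)"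
  have bound: "\<bar>x i k\<bar> \<le> r" if "quad P \<Theta> x \<le> c" "i < players P" "k < dims P i" for x i k
  proof -
    have "(i, k) \<in> set (coord_pairs P)" using that by (simp add: set_coord_pairs)
    then obtain b where b: "b < total_dim P" "coord_pairs P ! b = (i, k)"
      by (metis in_set_conv_nth length_coord_pairs)
    let ?v = "bracket1 P x"
    have "(x i k)\<^sup>2 = (vec_index ?v (Suc b))\<^sup>2"
      using b by (simp add: bracket1_index)
    also have "\<dots> \<le> (\<Sum>a<?d. (vec_index ?v a)\<^sup>2)"
      using b by (intro member_le_sum) auto
    finally have "\<alpha> * (x i k)\<^sup>2 \<le> \<alpha> * (\<Sum>a<?d. (vec_index ?v a)\<^sup>2)"
      using \<alpha>(1) by simp
    also have "\<dots> \<le> c"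
      using \<alpha>(2)[OF bracket1_carrier, of x] that(1) by (simp add: quad_def)
    finally have "(x i k)\<^sup>2 \<le> c / \<alpha>"
      using \<alpha>(1) by (simp add: field_simps)
    then show ?thesis
      unfolding r_def by (metis real_sqrt_abs real_sqrt_le_mono)
  qed
  \<comment> \<open>Free coordinates range over an interval, all others over the singleton
    prescribed by \<open>space_of_eq\<close>; the compactness of \<open>B\<close> takes Tychonoff's
    theorem twice, once for each index.\<close>
  define B where "B = PiE UNIV (\<lambda>i. PiE UNIV (\<lambda>k.
    if i < players P \<and> k < dims P i then {-r..r}
    else {if i < players P then undefined else (undefined :: nat \<Rightarrow> real) k}))"
  have "compact B"
    unfolding B_def by (intro compact_PiE_UNIV) auto
  moreover have "closed (space_of P \<inter> {x. quad P \<Theta> x \<le> c})"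
    by (intro closed_Int closed_space_of closed_Collect_le continuous_on_quad[OF \<Theta>]
        continuous_on_const)
  moreover have "space_of P \<inter> {x. quad P \<Theta> x \<le> c} \<subseteq> B"
  proof
    fix x assume x: "x \<in> space_of P \<inter> {x. quad P \<Theta> x \<le> c}"
    have "- r \<le> x i k \<and> x i k \<le> r" if "i < players P" "k < dims P i" for i k
      using bound[of x i k] x that by auto
    then show "x \<in> B"
      using x by (auto simp: B_def space_of_eq)
  qed
  ultimately show ?thesis
    by (metis compact_Int_closed inf.absorb_iff2)
qed

text \<open>Weierstrass' theorem on the feasible points that are no worse than a fixed feasible
  point \<open>x0\<close>.\<close>

lemma U_opt_exists:
  assumes "is_nep P" and "\<forall>i<players P. is_left_inverse P i (H i)"
    and \<Theta>: "pos_def (total_dim P + 1) \<Theta>" and ne: "U_feas P H K \<noteq> {}"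
  obtains u where "U_opt P H \<Theta> K u"
proof -
  obtain x0 where x0: "x0 \<in> U_feas P H K" using ne by blast
  let ?C = "(space_of P \<inter> {x. quad P \<Theta> x \<le> quad P \<Theta> x0}) \<inter> U_feas P H K"
  have sub: "U_feas P H K \<subseteq> space_of P" by (auto simp: U_feas_def kkt_def)
  have "compact ?C"
    using compact_quad_sublevel[OF \<Theta>] closed_U_feas[OF assms(1,2)] by (rule compact_Int_closed)
  moreover have "?C \<noteq> {}" using x0 sub by blast
  moreover have "continuous_on ?C (quad P \<Theta>)"
    by (rule continuous_on_subset[OF continuous_on_quad]) (use \<Theta> in \<open>simp_all add: pos_def_def\<close>)
  ultimately have "\<exists>u\<in>?C. \<forall>y\<in>?C. quad P \<Theta> u \<le> quad P \<Theta> y"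
    by (rule continuous_attains_inf)
  then obtain u where u: "u \<in> ?C" "\<forall>y\<in>?C. quad P \<Theta> u \<le> quad P \<Theta> y"
    by blast
  \<comment> \<open>A feasible \<open>y\<close> outside the compact set has a larger value than
    \<open>x0\<close>, hence a larger value than \<open>u\<close>.\<close>
  have "quad P \<Theta> u \<le> quad P \<Theta> y" if "y \<in> U_feas P H K" for y
    using u that sub by (cases "quad P \<Theta> y \<le> quad P \<Theta> x0") auto
  then have "U_opt P H \<Theta> K u"
    using u by (auto simp: U_opt_def is_arg_min_linorder)
  then show ?thesis by (rule that)
qed

section \<open>Runs of the algorithm\<close>

text \<open>The points of \<open>kkt P H - nash_equilibria P\<close> excluded by the cuts so far;
  their number bounds the loop counter.\<close>

definition removed :: "nep \<Rightarrow> (nat \<Rightarrow> nat rpoly mat) \<Rightarrow> cuts \<Rightarrow> point set" where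
  "removed P H K = kkt P H - nash_equilibria P - U_feas P H K"

text \<open>At \<open>Step3\<close> the invariant also records how \<open>\<omega>\<close> and
  \<open>u\<close> arose: this is what shows that the next cuts exclude a new point and that
  optimizers for these cuts exist.\<close>

fun run_inv :: "nep \<Rightarrow> (nat \<Rightarrow> nat rpoly mat) \<Rightarrow> state \<Rightarrow> bool" where
  "run_inv P H (Step1 K l) \<longleftrightarrow> l \<le> card (removed P H K)"
| "run_inv P H (Step2 K u l) \<longleftrightarrow> l \<le> card (removed P H K) \<and> u \<in> U_feas P H K"
| "run_inv P H (Step3 K u \<omega> l) \<longleftrightarrow> l \<le> card (removed P H K) \<and> u \<in> U_feas P H K \<and>
     (\<forall>i<players P. L_value P i u (\<omega> i)) \<and> (\<exists>i<players P. \<omega> i < 0)"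
| "run_inv P H (Stopped r l) \<longleftrightarrow> l \<le> card (kkt P H - nash_equilibria P)"

text \<open>No feasible deviation from an equilibrium lowers a player's objective. Used in the
  contrapositive: a negative value certifies that \<open>u\<close> is no equilibrium.\<close>

lemma nash_L_value_nonneg:
  assumes "u \<in> nash_equilibria P" and "i < players P" and "L_value P i u w"
  shows "w \<ge> 0"
proof -
  obtain v where v: "L_opt P i u v" "w = L_obj P i u v"
    using assms(3) by (auto simp: L_value_def)
  have "is_arg_min (\<lambda>v. peval2 (u(i := v)) (obj P i)) (\<lambda>v. v \<in> feas P i) (u i)"
    using assms(1,2) by (auto simp: nash_equilibria_def)
  then have "peval2 (u(i := u i)) (obj P i) \<le> peval2 (u(i := v)) (obj P i)"
    using v(1) by (auto simp: is_arg_min_linorder L_opt_def)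
  then show ?thesis by (simp add: v(2) L_obj_def)
qed

text \<open>All minimizers share one value. Hence every cut chosen in Step 3 attains
  \<open>\<omega> i\<close>, even if Step 2 computed that value from another minimizer.\<close>

lemma L_opt_value_unique:
  assumes "L_opt P i u v" and "L_value P i u w"
  shows "L_obj P i u v = w"
  using assms by (auto simp: L_value_def L_opt_def is_arg_min_linorder intro: antisym)

lemma U_feas_antimono:
  assumes "\<And>i. K i \<subseteq> K' i"
  shows "U_feas P H K' \<subseteq> U_feas P H K"
  using assms unfolding U_feas_def by blast

lemma U_feas_cutD:
  assumes "x \<in> U_feas P H K" and "i < players P" and "v \<in> K i"
  shows "L_obj P i x v \<ge> 0"
  using assms unfolding U_feas_def L_obj_def by blast

text \<open>Some new cut \<open>v\<close> satisfies \<open>L_obj P i u v < 0\<close>, so it violates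
  the constraint of (U) at \<open>u\<close> itself. The strict bound leaves room for the increment
  of the counter.\<close>

lemma loops_less_card_removed:
  assumes fin: "finite (kkt P H - nash_equilibria P)"
    and inv: "run_inv P H (Step3 K u \<omega> l)"
    and V: "\<forall>i<players P. \<omega> i < 0 \<longrightarrow> finite (V i) \<and> V i \<noteq> {} \<and> (\<forall>v\<in>V i. L_opt P i u v)"
  shows "l < card (removed P H (\<lambda>i. if i < players P \<and> \<omega> i < 0 then K i \<union> V i else K i))"
proof -
  define K' where "K' = (\<lambda>i. if i < players P \<and> \<omega> i < 0 then K i \<union> V i else K i)"
  have l: "l \<le> card (removed P H K)" and u: "u \<in> U_feas P H K"
    and L: "\<And>i. i < players P \<Longrightarrow> L_value P i u (\<omega> i)"
    using inv by simp_all
  obtain i where i: "i < players P" "\<omega> i < 0"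
    using inv by auto
  obtain v where v: "v \<in> V i" "L_opt P i u v"
    using V i by blast
  have "v \<in> K' i"
    using v(1) i by (simp add: K'_def)
  moreover have "L_obj P i u v < 0"
    using L_opt_value_unique[OF v(2) L[OF i(1)]] i by simp
  ultimately have "u \<notin> U_feas P H K'"
    using U_feas_cutD[OF _ i(1)] by (metis not_le)
  moreover have "u \<in> kkt P H"
    using u by (simp add: U_feas_def)
  moreover have "u \<notin> nash_equilibria P"
    using nash_L_value_nonneg[OF _ i(1) L[OF i(1)]] i(2) by (metis not_le)
  moreover have "U_feas P H K' \<subseteq> U_feas P H K"
    by (rule U_feas_antimono) (simp add: K'_def)
  \<comment> \<open>Inclusion holds because further cuts only shrink the feasible set;
    \<open>u\<close> makes it strict, being feasible for \<open>K\<close> but not for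
    \<open>K'\<close>.\<close>
  ultimately have "removed P H K \<subset> removed P H K'"
    using u unfolding removed_def by blast
  moreover have "finite (removed P H K')"
    using fin by (simp add: removed_def)
  ultimately have "l < card (removed P H K')"
    using l psubset_card_mono le_less_trans by metis
  then show ?thesis
    unfolding K'_def .
qed

lemma card_removed_le:
  assumes "finite (kkt P H - nash_equilibria P)"
  shows "card (removed P H K) \<le> card (kkt P H - nash_equilibria P)"
  using assms by (intro card_mono) (auto simp: removed_def)

lemma run_inv_step:
  assumes fin: "finite (kkt P H - nash_equilibria P)"
    and "step P H \<Theta> s t" and "run_inv P H s"
  shows "run_inv P H t"
  using assms(2,3)
proof cases
  case (add_cuts \<omega> V u K l)
  have "run_inv P H (Step3 K u \<omega> l)"
    using assms(3) unfolding add_cuts(1) .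
  from loops_less_card_removed[OF fin this add_cuts(3)] show ?thesis
    unfolding add_cuts(2) run_inv.simps by (rule Suc_leI)
qed (auto simp: U_opt_def is_arg_min_def intro: order_trans[OF _ card_removed_le[OF fin]])

section \<open>Termination measure and exclusion of infinite runs\<close>

text \<open>A full loop takes three steps, hence the weight 3 on the remaining loops; the offsets 3,
  2, 1 count down within a loop.\<close>

fun state_measure :: "nat \<Rightarrow> state \<Rightarrow> nat" where
  "state_measure L (Step1 K l) = 3 * (L - l) + 3"
| "state_measure L (Step2 K u l) = 3 * (L - l) + 2"
| "state_measure L (Step3 K u \<omega> l) = 3 * (L - l) + 1"
| "state_measure L (Stopped r l) = 0"

text \<open>The critical case is the return to Step 1, where the offset rises from 1 to 3. There
  \<open>l\<close> is strictly below the bound, so the truncated difference really drops by one and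
  the measure falls by 1.\<close>

lemma state_measure_step:
  assumes fin: "finite (kkt P H - nash_equilibria P)"
    and "step P H \<Theta> s t" and "run_inv P H s"
  shows "state_measure (card (kkt P H - nash_equilibria P)) t <
    state_measure (card (kkt P H - nash_equilibria P)) s"
  using assms(2,3)
proof cases
  case (add_cuts \<omega> V u K l)
  have "run_inv P H (Step3 K u \<omega> l)"
    using assms(3) unfolding add_cuts(1) .
  from less_le_trans[OF loops_less_card_removed[OF fin this add_cuts(3)] card_removed_le[OF fin]]
  have "l < card (kkt P H - nash_equilibria P)" .
  then show ?thesis using add_cuts by simp
qed auto

lemma run_inv_initial: "run_inv P H initial"
  by (simp add: initial_def)

lemma no_infinite_run:
  assumes fin: "finite (kkt P H - nash_equilibria P)"
  shows "\<not> infinite_run P H \<Theta> \<sigma>"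
proof
  assume run: "infinite_run P H \<Theta> \<sigma>"
  then have step: "step P H \<Theta> (\<sigma> t) (\<sigma> (Suc t))" for t
    by (simp add: infinite_run_def)
  have inv: "run_inv P H (\<sigma> t)" for t
  proof (induction t)
    case 0
    show ?case using run run_inv_initial by (simp add: infinite_run_def)
  next
    case (Suc t)
    then show ?case by (rule run_inv_step[OF fin step])
  qed
  have "state_measure (card (kkt P H - nash_equilibria P)) (\<sigma> (Suc t)) <
      state_measure (card (kkt P H - nash_equilibria P)) (\<sigma> t)" for t
    by (rule state_measure_step[OF fin step inv])
  then show False
    using wf_measure[of "state_measure (card (kkt P H - nash_equilibria P))"]
    unfolding wf_iff_no_infinite_down_chain in_measure by blast
qed

lemma successively_invariant:
  assumes "successively R xs" and "xs \<noteq> []" and "Q (hd xs)"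
    and "\<And>x y. R x y \<Longrightarrow> Q x \<Longrightarrow> Q y"
  shows "\<forall>x\<in>set xs. Q x"
  using assms(1-3)
proof (induction xs)
  case step: (Cons x xs)
  show ?case
  proof (cases xs)
    case Nil
    then show ?thesis using step.prems by simp
  next
    case (Cons y ys)
    then have "Q y" using step.prems assms(4)[of x y] by simp
    then show ?thesis using Cons step.IH step.prems by simp
  qed
qed simp

section \<open>Absence of deadlock and the final bound\<close>

text \<open>Every other state has a successor: Step 1 because a nonempty feasible set contains an
  optimizer, Step 2 by solvability of the problems (L), Step 3 by the invariant.\<close>

lemma stuck_state_stopped:
  assumes "is_nep P" and "\<forall>i<players P. is_left_inverse P i (H i)"
    and \<Theta>: "pos_def (total_dim P + 1) \<Theta>"
    and inv: "run_inv P H s" and stuck: "\<nexists>t. step P H \<Theta> s t"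
    and solv: "\<And>K u l i. s = Step2 K u l \<Longrightarrow> i < players P \<Longrightarrow> \<exists>v. L_opt P i u v"
  shows "\<exists>r l. s = Stopped r l"
proof (cases s)
  case (Step1 K l)
  show ?thesis
  proof (cases "U_feas P H K = {}")
    case True
    then show ?thesis using stuck Step1 step.infeasible by blast
  next
    case False
    then obtain u where "U_opt P H \<Theta> K u"
      by (rule U_opt_exists[OF assms(1,2) \<Theta>])
    then show ?thesis using stuck Step1 step.optimizer by blast
  qed
next
  case (Step2 K u l)
  then have "\<forall>i. \<exists>w. i < players P \<longrightarrow> L_value P i u w"
    using solv unfolding L_value_def by blast
  then obtain \<omega> where \<omega>: "\<forall>i<players P. L_value P i u (\<omega> i)"
    by metis
  show ?thesis
  proof (cases "\<forall>i<players P. \<omega> i \<ge> 0")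
    case True
    then show ?thesis using stuck Step2 step.found[OF \<omega>] by blast
  next
    case False
    then have "\<exists>i<players P. \<omega> i < 0" by (auto simp: not_le)
    then show ?thesis using stuck Step2 step.not_NE[OF \<omega>] by blast
  qed
next
  case (Step3 K u \<omega> l)
  \<comment> \<open>A value of (L) is by definition attained, so an optimizer is at hand; its
    singleton is an admissible choice of new cuts.\<close>
  then have "\<forall>i. \<exists>v. i < players P \<longrightarrow> L_opt P i u v"
    using inv by (auto simp: L_value_def)
  then obtain v where "\<forall>i<players P. L_opt P i u (v i)" by metis
  then have "\<forall>i<players P. \<omega> i < 0 \<longrightarrow>
      finite {v i} \<and> {v i} \<noteq> {} \<and> (\<forall>w\<in>{v i}. L_opt P i u w)"
    by simp
  from step.add_cuts[OF this] show ?thesis using stuck Step3 by blast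
qed auto

text \<open>The last state of a maximal run satisfies the invariant and has no successor, so it is
  stopped; the invariant of a stopped state is exactly the bound on the counter.\<close>

lemma pos_def_terminates_within:
  assumes "is_nep P" and "\<forall>i<players P. is_left_inverse P i (H i)"
    and fin: "finite (kkt P H - nash_equilibria P)"
    and "pos_def (total_dim P + 1) \<Theta>"
  shows "terminates_within P H \<Theta> (card (kkt P H - nash_equilibria P))"
  unfolding terminates_within_def
proof (intro conjI allI impI)
  show "\<nexists>\<sigma>. infinite_run P H \<Theta> \<sigma>"
    using no_infinite_run[OF fin] by blast
  fix ss
  assume ss: "maximal_run P H \<Theta> ss \<and> L_solvable P ss"
  then have ne: "ss \<noteq> []" by (simp add: maximal_run_def)
  have "\<forall>s\<in>set ss. run_inv P H s"
    using ss run_inv_initial run_inv_step[OF fin]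
    by (intro successively_invariant[of "step P H \<Theta>"]) (auto simp: maximal_run_def)
  then have inv: "run_inv P H (last ss)" using ne by simp
  have "\<exists>r l. last ss = Stopped r l"
  proof (rule stuck_state_stopped[OF assms(1,2,4) inv])
    show "\<nexists>t. step P H \<Theta> (last ss) t" using ss by (simp add: maximal_run_def)
    show "\<exists>v. L_opt P i u v" if "last ss = Step2 K u l" "i < players P" for K u l i
      using ss that last_in_set[OF ne] by (auto simp: L_solvable_def)
  qed
  then show "\<exists>r l. last ss = Stopped r l \<and> l \<le> card (kkt P H - nash_equilibria P)"
    using inv by auto
qed

theorem theorem3p2:
  fixes P :: nep and H :: "nat \<Rightarrow> nat rpoly mat"
  assumes "is_nep P"
    and "\<forall>i<players P. nonsingular P i"
    and "\<forall>i<players P. is_left_inverse P i (H i)"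
    and "finite (kkt P H - nash_equilibria P)"
  shows "AE \<theta> in upper_entries (total_dim P + 1).
    pos_def (total_dim P + 1) (sym_mat (total_dim P + 1) \<theta>) \<longrightarrow>
    terminates_within P H (sym_mat (total_dim P + 1) \<theta>) (card (kkt P H - nash_equilibria P))"
  \<comment> \<open>The implication is established at each point \<open>\<theta>\<close>, which
    yields the almost-everywhere statement.\<close>
  using pos_def_terminates_within[OF assms(1,3,4)] by (intro AE_I2 impI)

end
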